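(* Let $T$ be a tree, let $u,v$ be distinct vertices of $T$, and let $x_0x_1\cdots x_d$ be the unique $u$--$v$ path in $T$, with $x_0=u$ and $x_d=v$. Assume $d\ge 4$, and let $F_{u,v}=T-N[u]-N[v]$. Then the vertices of this path that survive in $F_{u,v}$ are exactly $x_2,x_3,\dots,x_{d-2}$, and they induce a path on $d-3$ vertices. Consequently, if $d$ is even, this surviving path has odd order and hence a unique central vertex; if $d$ is odd, it has even order and hence a central edge.
   Context: $N[w]$ denotes the closed neighborhood of $w$ in $T$, and $T-N[u]-N[v]$ is the subgraph of $T$ induced by $V(T)\setminus(N[u]\cup N[v])$. *)

theory Defs
  imports "Graph_Theory.Graph_Theory"
begin

text \<open>
  Simple undirected graphs are symmetric digraphs without loops and parallel arcs, as in the
  locale \<^locale>\<open>graph\<close>, but without requiring finiteness. An edge is thus a pair of opposite arcs.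
\<close>

definition simple_graph :: "('a, 'b) pre_digraph \<Rightarrow> bool" where
  "simple_graph G \<longleftrightarrow> sym_digraph G \<and> loopfree_digraph G \<and> nomulti_digraph G"

text \<open>
  The library's \<^const>\<open>tree\<close> does not fit symmetric digraphs, since it counts the closed
  walk $a, b, a$ as a cycle. In a simple graph the cycles in the undirected sense are exactly the
  directed ones of length at least 3. The name of \<open>connected\<close> is qualified because
  the topological notion has the same name; a connected graph is nonempty.
\<close>

definition undirected_tree :: "('a, 'b) pre_digraph \<Rightarrow> bool" where
  "undirected_tree G \<longleftrightarrow> simple_graph G \<and> Digraph_Component.connected G \<and>
     \<not> (\<exists>p. pre_digraph.cycle G p \<and> length p \<ge> 3)"

definition closed_neighborhood :: "('a, 'b) pre_digraph \<Rightarrow> 'a \<Rightarrow> 'a set" where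
  "closed_neighborhood G w = insert w {x \<in> verts G. w \<rightarrow>\<^bsub>G\<^esub> x}"

definition path_graph :: "('a, 'b) pre_digraph \<Rightarrow> bool" where
  "path_graph G \<longleftrightarrow> simple_graph G \<and>
     (\<exists>ys. ys \<noteq> [] \<and> distinct ys \<and> verts G = set ys \<and>
        arcs_ends G = set (vwalk_arcs ys) \<union> (set (vwalk_arcs ys))\<inverse>)"

text \<open>
  Distance is the least number of arcs of a walk, i.e. the library's shortest-path
  cost for unit weights; it is infinite between different components.
\<close>

definition graph_distance :: "('a, 'b) pre_digraph \<Rightarrow> 'a \<Rightarrow> 'a \<Rightarrow> ereal" where
  "graph_distance G a b = wf_digraph.\<mu> G (\<lambda>_. 1) a b"

definition eccentricity :: "('a, 'b) pre_digraph \<Rightarrow> 'a \<Rightarrow> ereal" where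
  "eccentricity G a = (SUP b\<in>verts G. graph_distance G a b)"

definition central_vertex :: "('a, 'b) pre_digraph \<Rightarrow> 'a \<Rightarrow> bool" where
  "central_vertex G c \<longleftrightarrow>
     c \<in> verts G \<and> (\<forall>w\<in>verts G. eccentricity G c \<le> eccentricity G w)"

definition central_edge :: "('a, 'b) pre_digraph \<Rightarrow> 'a \<Rightarrow> 'a \<Rightarrow> bool" where
  "central_edge G a b \<longleftrightarrow> a \<rightarrow>\<^bsub>G\<^esub> b \<and> central_vertex G a \<and> central_vertex G b"

end

theory Submission
  imports Defs
begin

text \<open>
  A chord of a path in a tree would close a cycle, so adjacency between vertices of the path is
  adjacency of indices. Hence the closed neighborhoods of the ends meet the path in its first two
  and last two vertices, and the remaining vertices induce a path. In a path on $n$ vertices the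
  index is a 1-Lipschitz function along arcs, so the distance is the difference of the indices and
  the $i$-th vertex has eccentricity $\max(i, n-1-i)$, which is minimal exactly at
  $\lfloor (n-1)/2 \rfloor$ and $\lfloor n/2 \rfloor$.
\<close>

section \<open>Walks as vertex lists and as arc lists\<close>

lemma set_vwalk_arcs_conv_nth:
  "set (vwalk_arcs p) = {(p ! i, p ! Suc i) | i. Suc i < length p}"
proof (induct p rule: vwalk_arcs.induct)
  case (3 x y xs)
  have "{((x # y # xs) ! i, (x # y # xs) ! Suc i) | i. Suc i < length (x # y # xs)} =
      insert (x, y) {((y # xs) ! i, (y # xs) ! Suc i) | i. Suc i < length (y # xs)}"
    (is "?A = insert _ ?B")
  proof (intro equalityI subsetI)
    fix e assume "e \<in> ?A"
    then obtain i where "e = ((x # y # xs) ! i, (x # y # xs) ! Suc i)" "Suc i < length (x # y # xs)"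
      by blast
    then show "e \<in> insert (x, y) ?B" by (cases i) auto
  next
    fix e assume "e \<in> insert (x, y) ?B"
    then consider "e = (x, y)" | i where "e = ((y # xs) ! i, (y # xs) ! Suc i)" "Suc i < length (y # xs)"
      by blast
    then show "e \<in> ?A"
    proof cases
      case 1 then show ?thesis by (auto intro: exI[of _ 0])
    next
      case 2 then show ?thesis by (auto intro: exI[of _ "Suc i"])
    qed
  qed
  then show ?case using 3 by simp
qed auto

lemma vwalk_conv_nth:
  "vwalk p G \<longleftrightarrow> p \<noteq> [] \<and> set p \<subseteq> verts G \<and> (\<forall>i. Suc i < length p \<longrightarrow> p ! i \<rightarrow>\<^bsub>G\<^esub> p ! Suc i)"
  by (auto simp: vwalk_def set_vwalk_arcs_conv_nth)

lemma vwalk_infix: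
  assumes "vwalk p G" "i \<le> j" "j < length p"
  shows "vwalk (take (Suc (j - i)) (drop i p)) G"
  using assms by (auto simp: vwalk_conv_nth dest!: in_set_takeD in_set_dropD)

lemma infix_hd_last:
  assumes "i \<le> j" "j < length p"
  shows "hd (take (Suc (j - i)) (drop i p)) = p ! i" "last (take (Suc (j - i)) (drop i p)) = p ! j"
  using assms by (simp_all add: hd_conv_nth last_conv_nth)

text \<open>Bridges two notions of walk: the given path is a list of vertices, while cycles and
  distances are defined through lists of arcs.\<close>

lemma (in wf_digraph) vwalk_imp_awalk:
  assumes "vwalk p G"
  obtains q where "awalk (hd p) q (last p)" "awalk_verts (hd p) q = p"
proof -
  have "\<exists>q. awalk (hd p) q (last p) \<and> awalk_verts (hd p) q = p"
    using assms
  proof induct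
    case (Base u)
    then show ?case by (auto intro!: exI[of _ "[]"] simp: awalk_Nil_iff)
  next
    case (Cons u v p)
    then obtain e where e: "e \<in> arcs G" "tail G e = u" "head G e = v" by auto
    from Cons obtain q where "awalk v q (last (v # p))" "awalk_verts v q = v # p" by auto
    with e show ?case by (auto intro!: exI[of _ "e # q"] simp: awalk_Cons_iff)
  qed
  then show ?thesis using that by blast
qed

text \<open>Appending the closing arc to the arc walk of \<open>p\<close> gives the vertex list
  \<open>p @ [hd p]\<close>, whose tail is a rotation of \<open>p\<close> and hence distinct. The
  length is recorded because \<open>undirected_tree\<close> forbids only cycles of length at least
  3.\<close>

lemma (in wf_digraph) closed_vpath_imp_cycle:
  assumes "vpath p G" "last p \<rightarrow>\<^bsub>G\<^esub> hd p"
  obtains c where "cycle c" "length c = length p"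
proof -
  obtain q where q: "awalk (hd p) q (last p)" "awalk_verts (hd p) q = p"
    using assms vwalk_imp_awalk by blast
  obtain e where e: "e \<in> arcs G" "tail G e = last p" "head G e = hd p"
    using assms(2) by auto
  have len: "length p = Suc (length q)" using length_awalk_verts[of "hd p" q] q(2) by simp
  have "awalk (hd p) (q @ [e]) (hd p)"
    using q e by (auto intro!: awalk_appendI simp: awalk_simps)
  moreover have "awalk_verts (hd p) (q @ [e]) = p @ [hd p]"
  proof -
    have "map (tail G) q @ [last p] = p"
      using q by (cases "q = []") (auto simp: awalk_verts_conv)
    then show ?thesis using e by (simp add: awalk_verts_conv)
  qed
  moreover have "distinct (tl (p @ [hd p]))"
    using assms(1) by (cases p) (auto simp: vpath_def)
  ultimately have "cycle (q @ [e])" unfolding cycle_def by auto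
  then show ?thesis using len that by simp
qed

section \<open>Adjacency along a path of a tree\<close>

lemma undirected_tree_no_chord:
  assumes "undirected_tree G" "vpath p G" "i < j" "j < length p" "p ! j \<rightarrow>\<^bsub>G\<^esub> p ! i"
  shows "j = Suc i"
proof (rule ccontr)
  assume "j \<noteq> Suc i"
  interpret sym_digraph G using assms(1) by (simp add: undirected_tree_def simple_graph_def)
  \<comment> \<open>The segment from index \<open>i\<close> to index \<open>j\<close>, closed by the
    chord. It has \<open>j - i + 1\<close> vertices, which is at least 3 once \<open>j\<close> is
    not \<open>Suc i\<close>.\<close>
  let ?q = "take (Suc (j - i)) (drop i p)"
  have "vpath ?q G" using assms vwalk_infix[of p G i j] by (auto simp: vpath_def)
  moreover have "last ?q \<rightarrow>\<^bsub>G\<^esub> hd ?q" using assms infix_hd_last[of i j p] by simp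
  ultimately obtain c where "cycle c" "length c = length ?q" by (rule closed_vpath_imp_cycle)
  moreover have "length ?q \<ge> 3" using assms \<open>j \<noteq> Suc i\<close> by simp
  ultimately show False using assms(1) unfolding undirected_tree_def by metis
qed

text \<open>This is how acyclicity enters the main theorem: the absence of chords reduces adjacency
  to index arithmetic. Symmetry of the graph covers both orders of the indices, and equal indices
  would give a loop.\<close>

lemma undirected_tree_vpath_adj_iff:
  assumes "undirected_tree G" "vpath p G" "i < length p" "j < length p"
  shows "p ! i \<rightarrow>\<^bsub>G\<^esub> p ! j \<longleftrightarrow> j = Suc i \<or> i = Suc j"
proof
  interpret sym_digraph G using assms(1) by (simp add: undirected_tree_def simple_graph_def)
  interpret loopfree_digraph G using assms(1) by (simp add: undirected_tree_def simple_graph_def)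
  show "j = Suc i \<or> i = Suc j" if "p ! i \<rightarrow>\<^bsub>G\<^esub> p ! j"
  proof (cases i j rule: linorder_cases)
    case less
    then show ?thesis
      using undirected_tree_no_chord[OF assms(1,2) less assms(4)] graph_symmetric[OF that] by blast
  next
    case equal then show ?thesis using that adj_not_same by blast
  next
    case greater
    then show ?thesis using undirected_tree_no_chord[OF assms(1,2) greater assms(3) that] by blast
  qed
  show "p ! i \<rightarrow>\<^bsub>G\<^esub> p ! j" if "j = Suc i \<or> i = Suc j"
    using that assms graph_symmetric by (auto simp: vpath_def vwalk_conv_nth)
qed

section \<open>Induced subgraphs\<close>

lemma dominates_induce_subgraph_iff:
  "a \<rightarrow>\<^bsub>G \<restriction> S\<^esub> b \<longleftrightarrow> a \<rightarrow>\<^bsub>G\<^esub> b \<and> a \<in> S \<and> b \<in> S"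
  by (auto simp: arcs_ends_conv)

lemma simple_graph_induce_subgraph:
  assumes "simple_graph G"
  shows "simple_graph (G \<restriction> S)"
proof -
  interpret sym_digraph G using assms by (simp add: simple_graph_def)
  interpret loopfree_digraph G using assms by (simp add: simple_graph_def)
  interpret nomulti_digraph G using assms by (simp add: simple_graph_def)
  interpret S: wf_digraph "G \<restriction> S" ..
  have "symmetric (G \<restriction> S)"
    unfolding symmetric_def
    by (intro symI) (simp add: dominates_induce_subgraph_iff graph_symmetric)
  then show ?thesis
    unfolding simple_graph_def
    by (intro conjI S.sym_digraphI; unfold_locales) (auto intro: no_multi_arcs dest: no_loops)
qed

section \<open>Distances, eccentricities and central vertices of a path\<close>

lemma (in wf_digraph) awalk_lipschitz:
  fixes f :: "'a \<Rightarrow> real"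
  assumes "awalk a p b" "\<And>x y. x \<rightarrow>\<^bsub>G\<^esub> y \<Longrightarrow> \<bar>f x - f y\<bar> \<le> 1"
  shows "\<bar>f a - f b\<bar> \<le> length p"
  using assms(1)
proof (induct p arbitrary: a)
  case (Cons e p)
  then have "a \<rightarrow>\<^bsub>G\<^esub> head G e" "\<bar>f (head G e) - f b\<bar> \<le> length p"
    by (auto simp: awalk_Cons_iff in_arcs_imp_in_arcs_ends)
  with assms(2)[of a "head G e"] show ?case by simp
qed (simp add: awalk_Nil_iff)

lemma (in wf_digraph) awalk_cost_unit: "awalk_cost (\<lambda>_. 1) p = length p"
  by (induct p) auto

lemma (in wf_digraph) graph_distance_eq_INF:
  "graph_distance G a b = (INF p\<in>{p. awalk a p b}. ereal (length p))"
  by (simp add: graph_distance_def \<mu>_def awalk_cost_unit)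

text \<open>The segment of \<open>ys\<close> between the two indices is a walk that attains the
  bound. Conversely, the index changes by 1 along each arc, so no walk is shorter.\<close>

lemma path_graph_distance:
  assumes "simple_graph G" "distinct ys" "verts G = set ys"
    and ends: "arcs_ends G = set (vwalk_arcs ys) \<union> (set (vwalk_arcs ys))\<inverse>"
    and ij: "i < length ys" "j < length ys"
  shows "graph_distance G (ys ! i) (ys ! j) = ereal \<bar>real i - real j\<bar>"
proof -
  interpret sym_digraph G using assms(1) by (simp add: simple_graph_def)
  have walk: "vwalk ys G" using assms by (auto simp: vwalk_def)
  have "\<exists>q. awalk (ys ! i) q (ys ! j) \<and> real (length q) = \<bar>real i - real j\<bar>"
  proof -
    \<comment> \<open>The summand 1 appears because \<open>p\<close> lists vertices, while the
      distance counts arcs.\<close>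
    have "\<exists>p. vwalk p G \<and> hd p = ys ! i \<and> last p = ys ! j \<and> real (length p) = \<bar>real i - real j\<bar> + 1"
    proof (cases "i \<le> j")
      case True
      then show ?thesis
        using vwalk_infix[OF walk True ij(2)] infix_hd_last[OF True ij(2)] ij
        by (intro exI[of _ "take (Suc (j - i)) (drop i ys)"]) auto
    next
      case False
      then have le: "j \<le> i" by simp
      let ?p = "take (Suc (i - j)) (drop j ys)"
      \<comment> \<open>For \<open>j < i\<close> the segment is walked backwards, which symmetry of
        the graph permits.\<close>
      have "vwalk (rev ?p) G" using vwalk_rev_ex sym_arcs vwalk_infix[OF walk le ij(1)] by blast
      moreover have "hd (rev ?p) = ys ! i" "last (rev ?p) = ys ! j"
        using infix_hd_last[OF le ij(1)] by (simp_all only: hd_rev last_rev)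
      moreover have "real (length (rev ?p)) = \<bar>real i - real j\<bar> + 1" using le ij by auto
      ultimately show ?thesis by blast
    qed
    then obtain p where p: "vwalk p G" "hd p = ys ! i" "last p = ys ! j"
      "real (length p) = \<bar>real i - real j\<bar> + 1" by blast
    then obtain q where q: "awalk (hd p) q (last p)" "awalk_verts (hd p) q = p"
      using vwalk_imp_awalk by blast
    have "length p = Suc (length q)" using length_awalk_verts[of "hd p" q] q(2) by simp
    then show ?thesis using p q by (intro exI[of _ q]) auto
  qed
  then obtain q where q: "awalk (ys ! i) q (ys ! j)" "real (length q) = \<bar>real i - real j\<bar>" by blast
  \<comment> \<open>The index of a vertex, well determined because \<open>ys\<close> is distinct. It
    is real-valued so that differences are not truncated.\<close>
  define f where "f x = real (inv_into {..<length ys} ((!) ys) x)" for x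
  have f: "f (ys ! k) = k" if "k < length ys" for k
    using that assms(2) unfolding f_def by (subst inv_into_f_f) (auto simp: inj_on_nth)
  have lip: "\<bar>f x - f y\<bar> \<le> 1" if "x \<rightarrow>\<^bsub>G\<^esub> y" for x y
    using that unfolding ends set_vwalk_arcs_conv_nth by (auto simp: f)
  have "\<bar>real i - real j\<bar> \<le> length p" if "awalk (ys ! i) p (ys ! j)" for p
    using awalk_lipschitz[where f = f, OF that lip] by (simp only: f[OF ij(1)] f[OF ij(2)])
  then show ?thesis unfolding graph_distance_eq_INF
    using q by (intro antisym INF_greatest) (auto intro: INF_lower2)
qed

text \<open>A vertex farthest from the \<open>i\<close>-th one is an end of the path, and the two
  ends lie at distances \<open>i\<close> and \<open>length ys - 1 - i\<close>.\<close>

lemma path_graph_eccentricity: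
  assumes "simple_graph G" "distinct ys" "verts G = set ys"
    "arcs_ends G = set (vwalk_arcs ys) \<union> (set (vwalk_arcs ys))\<inverse>" "i < length ys"
  shows "eccentricity G (ys ! i) = ereal (real (max i (length ys - 1 - i)))"
proof -
  have dist: "graph_distance G (ys ! i) (ys ! j) = ereal \<bar>real i - real j\<bar>" if "j < length ys" for j
    using path_graph_distance assms that by blast
  have "eccentricity G (ys ! i) = (SUP j\<in>{..<length ys}. graph_distance G (ys ! i) (ys ! j))"
    unfolding eccentricity_def assms(3) set_conv_nth by (rule arg_cong[of _ _ Sup]) auto
  also have "\<dots> = (SUP j\<in>{..<length ys}. ereal \<bar>real i - real j\<bar>)"
    by (intro SUP_cong) (auto simp: dist)
  also have "\<dots> = ereal (real (max i (length ys - 1 - i)))"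
  proof (intro antisym SUP_least)
    fix j assume "j \<in> {..<length ys}"
    then have "\<bar>real i - real j\<bar> \<le> real (max i (length ys - 1 - i))" using assms(5) by auto
    then show "ereal \<bar>real i - real j\<bar> \<le> ereal (real (max i (length ys - 1 - i)))" by simp
  next
    \<comment> \<open>The farther end, where the supremum is attained.\<close>
    define j where "j = (if i \<le> length ys - 1 - i then length ys - 1 else 0)"
    have "real (max i (length ys - 1 - i)) = \<bar>real i - real j\<bar>" "j < length ys"
      using assms(5) by (auto simp: j_def)
    then show "ereal (real (max i (length ys - 1 - i))) \<le> (SUP j\<in>{..<length ys}. ereal \<bar>real i - real j\<bar>)"
      by (intro SUP_upper2[of j]) auto
  qed
  finally show ?thesis .
qed

text \<open>Stating both middle indices covers the two parities at once: they coincide when the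
  number of vertices is odd and are consecutive when it is even.\<close>

lemma path_graph_central_vertex_iff:
  assumes "simple_graph G" "distinct ys" "ys \<noteq> []" "verts G = set ys"
    "arcs_ends G = set (vwalk_arcs ys) \<union> (set (vwalk_arcs ys))\<inverse>"
  shows "central_vertex G c \<longleftrightarrow>
    c = ys ! ((length ys - 1) div 2) \<or> c = ys ! (length ys div 2)"
proof -
  let ?n = "length ys"
  let ?e = "\<lambda>i. max i (?n - 1 - i)"
  have n: "?n > 0" using assms(3) by simp
  have ecc: "eccentricity G (ys ! i) = ereal (real (?e i))" if "i < ?n" for i
    using path_graph_eccentricity assms that by blast
  have "central_vertex G c \<longleftrightarrow> (\<exists>i<?n. c = ys ! i \<and> (\<forall>j<?n. ?e i \<le> ?e j))"
  proof
    assume "central_vertex G c"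
    then have c: "c \<in> set ys" "\<forall>w\<in>set ys. eccentricity G c \<le> eccentricity G w"
      by (auto simp: central_vertex_def assms(4))
    then obtain i where i: "i < ?n" "c = ys ! i" by (auto simp: in_set_conv_nth)
    have "?e i \<le> ?e j" if "j < ?n" for j
      using c(2)[rule_format, of "ys ! j"] that i(1) by (simp add: i(2) ecc)
    with i show "\<exists>i<?n. c = ys ! i \<and> (\<forall>j<?n. ?e i \<le> ?e j)" by blast
  next
    assume "\<exists>i<?n. c = ys ! i \<and> (\<forall>j<?n. ?e i \<le> ?e j)"
    then show "central_vertex G c"
      by (auto simp: central_vertex_def assms(4) in_set_conv_nth ecc simp del: max.bounded_iff)
  qed
  also have "\<dots> \<longleftrightarrow> (\<exists>i<?n. c = ys ! i \<and> (i = (?n - 1) div 2 \<or> i = ?n div 2))"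
  proof -
    have "(\<forall>j<?n. ?e i \<le> ?e j) \<longleftrightarrow> i = (?n - 1) div 2 \<or> i = ?n div 2" if "i < ?n" for i
    proof
      \<comment> \<open>One comparison suffices: at the index \<open>(?n - 1) div 2\<close> the
        value of \<open>?e\<close> is \<open>?n div 2\<close>, its minimum, and only the two middle
        indices stay within it.\<close>
      assume "\<forall>j<?n. ?e i \<le> ?e j"
      moreover have "(?n - 1) div 2 < ?n" using n by linarith
      ultimately have "?e i \<le> ?e ((?n - 1) div 2)" by blast
      then show "i = (?n - 1) div 2 \<or> i = ?n div 2" using that by linarith
    next
      assume "i = (?n - 1) div 2 \<or> i = ?n div 2"
      then show "\<forall>j<?n. ?e i \<le> ?e j" using that by (intro allI impI) linarith
    qed
    then show ?thesis by blast
  qed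
  also have "\<dots> \<longleftrightarrow> c = ys ! ((?n - 1) div 2) \<or> c = ys ! (?n div 2)"
  proof -
    have "(?n - 1) div 2 < ?n" "?n div 2 < ?n" using n by linarith+
    then show ?thesis by blast
  qed
  finally show ?thesis .
qed

section \<open>The surviving path and its centre\<close>

theorem lemma2p10:
  fixes T F P :: "('a, 'b) pre_digraph" and u v :: 'a and xs :: "'a list" and d :: nat
  assumes tree: "undirected_tree T"
    and u: "u \<in> verts T" and v: "v \<in> verts T" and "u \<noteq> v"
    and path: "vpath xs T" "hd xs = u" "last xs = v" "vwalk_length xs = d"
    and d: "d \<ge> 4"
    and F: "F = T \<restriction> (verts T - (closed_neighborhood T u \<union> closed_neighborhood T v))"
    and P: "P = F \<restriction> (set xs \<inter> verts F)"
  shows "set xs \<inter> verts F = {xs ! i | i. 2 \<le> i \<and> i \<le> d - 2}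
    \<and> path_graph P \<and> card (verts P) = d - 3
    \<and> (even d \<longrightarrow> odd (card (verts P)) \<and> (\<exists>!c. central_vertex P c))
    \<and> (odd d \<longrightarrow> even (card (verts P)) \<and> (\<exists>a b. central_edge P a b))"
proof -
  have len: "length xs = Suc d" using path d by simp
  have dist: "distinct xs" and walk: "vwalk xs T" using path by (auto simp: vpath_def)
  have "xs \<noteq> []" using len by auto
  have uv: "u = xs ! 0" "v = xs ! d"
    using path len \<open>xs \<noteq> []\<close> by (simp_all add: hd_conv_nth last_conv_nth flip: path(2,3))
  have simple: "simple_graph T" using tree by (simp add: undirected_tree_def)
  have verts_path: "xs ! i \<in> verts T" if "i \<le> d" for i
    using walk that len by (auto simp: vwalk_def)
  have adj: "xs ! i \<rightarrow>\<^bsub>T\<^esub> xs ! j \<longleftrightarrow> j = Suc i \<or> i = Suc j" if "i \<le> d" "j \<le> d" for i j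
    using undirected_tree_vpath_adj_iff[OF tree path(1)] that len by simp
  have eq: "xs ! i = xs ! j \<longleftrightarrow> i = j" if "i \<le> d" "j \<le> d" for i j
    using nth_eq_iff_index_eq[OF dist] that len by simp
  have vertsF: "verts F = verts T - (closed_neighborhood T u \<union> closed_neighborhood T v)"
    by (simp add: F)
  have inF: "xs ! i \<in> verts F \<longleftrightarrow> 2 \<le> i \<and> i \<le> d - 2" if "i \<le> d" for i
  proof -
    have nbh: "xs ! i \<in> closed_neighborhood T (xs ! j) \<longleftrightarrow> i = j \<or> i = Suc j \<or> j = Suc i"
      if "j \<le> d" for j
      by (simp add: closed_neighborhood_def verts_path adj eq that \<open>i \<le> d\<close>)
    show ?thesis
      \<comment> \<open>The two instances of \<open>nbh\<close> take \<open>j = 0\<close> and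
        \<open>j = d\<close>: the neighborhood of \<open>u\<close> removes the indices 0 and 1, that
        of \<open>v\<close> removes \<open>d - 1\<close> and \<open>d\<close>.\<close>
      unfolding vertsF uv Diff_iff Un_iff nbh[OF le0] nbh[OF order_refl]
      using verts_path[OF that] that d by simp linarith
  qed
  have surv: "set xs \<inter> verts F = {xs ! i | i. 2 \<le> i \<and> i \<le> d - 2}"
  proof (intro equalityI subsetI)
    fix x assume "x \<in> set xs \<inter> verts F"
    then obtain i where "x = xs ! i" "i \<le> d" "xs ! i \<in> verts F"
      using len by (auto simp: in_set_conv_nth less_Suc_eq_le)
    then show "x \<in> {xs ! i | i. 2 \<le> i \<and> i \<le> d - 2}" using inF by blast
  next
    fix x assume "x \<in> {xs ! i | i. 2 \<le> i \<and> i \<le> d - 2}"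
    then obtain i where "x = xs ! i" "2 \<le> i" "i \<le> d - 2" by blast
    then show "x \<in> set xs \<inter> verts F" using inF[of i] len by auto
  qed
  \<comment> \<open>Dropping two vertices at each end of the \<open>d + 1\<close> vertices of
    \<open>xs\<close> leaves \<open>d - 3\<close>, which is positive because
    \<open>d \<ge> 4\<close>.\<close>
  define ys where "ys = take (d - 3) (drop 2 xs)"
  have lys: "length ys = d - 3" using len d by (simp add: ys_def)
  have ys_nth: "ys ! i = xs ! (i + 2)" if "i < d - 3" for i
    using that len by (simp add: ys_def add.commute)
  have ys_ne: "ys \<noteq> []" using lys d by auto
  have ys_dist: "distinct ys" using dist by (simp add: ys_def)
  have ys_set: "set ys = set xs \<inter> verts F"
  proof -
    have "set ys = {xs ! (i + 2) | i. i < d - 3}"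
      unfolding set_conv_nth lys using ys_nth by (intro Collect_cong) metis
    also have "\<dots> = {xs ! i | i. 2 \<le> i \<and> i \<le> d - 2}"
    proof (intro equalityI subsetI)
      fix x assume "x \<in> {xs ! i | i. 2 \<le> i \<and> i \<le> d - 2}"
      then obtain i where "x = xs ! i" "2 \<le> i" "i \<le> d - 2" by blast
      \<comment> \<open>The shift by 2 is undone without truncation because
        \<open>2 \<le> i\<close>.\<close>
      then have "x = xs ! (i - 2 + 2)" "i - 2 < d - 3" using d by (simp only: le_add_diff_inverse2, linarith)
      then show "x \<in> {xs ! (i + 2) | i. i < d - 3}" by blast
    next
      fix x assume "x \<in> {xs ! (i + 2) | i. i < d - 3}"
      then obtain i where "x = xs ! (i + 2)" "i < d - 3" by blast
      moreover from this have "2 \<le> i + 2" "i + 2 \<le> d - 2" by linarith+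
      ultimately show "x \<in> {xs ! i | i. 2 \<le> i \<and> i \<le> d - 2}" by blast
    qed
    finally show ?thesis using surv by simp
  qed
  have vertsP: "verts P = set ys" by (simp add: P ys_set)
  have simpleP: "simple_graph P"
    unfolding P F by (intro simple_graph_induce_subgraph simple)
  \<comment> \<open>Both restrictions are induced, so together they keep exactly the arcs of
    \<open>T\<close> between surviving vertices. The index criterion \<open>adj\<close> thereby
    carries over to \<open>P\<close>.\<close>
  have domP: "a \<rightarrow>\<^bsub>P\<^esub> b \<longleftrightarrow> a \<rightarrow>\<^bsub>T\<^esub> b \<and> a \<in> set ys \<and> b \<in> set ys" for a b
  proof -
    have "a \<rightarrow>\<^bsub>P\<^esub> b \<longleftrightarrow> a \<rightarrow>\<^bsub>F\<^esub> b \<and> a \<in> set ys \<and> b \<in> set ys"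
      unfolding P by (simp add: dominates_induce_subgraph_iff flip: ys_set)
    moreover have "a \<rightarrow>\<^bsub>F\<^esub> b \<longleftrightarrow> a \<rightarrow>\<^bsub>T\<^esub> b \<and> a \<in> verts F \<and> b \<in> verts F"
      unfolding vertsF unfolding F by (rule dominates_induce_subgraph_iff)
    ultimately show ?thesis using ys_set by blast
  qed
  have adj_ys: "ys ! i \<rightarrow>\<^bsub>T\<^esub> ys ! j \<longleftrightarrow> j = Suc i \<or> i = Suc j" if "i < length ys" "j < length ys" for i j
    using that adj[of "i + 2" "j + 2"] lys by (simp add: ys_nth)
  have arcsP: "arcs_ends P = set (vwalk_arcs ys) \<union> (set (vwalk_arcs ys))\<inverse>"
  proof (intro set_eqI iffI)
    fix e assume "e \<in> arcs_ends P"
    then obtain i j where "e = (ys ! i, ys ! j)" "i < length ys" "j < length ys" "ys ! i \<rightarrow>\<^bsub>T\<^esub> ys ! j"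
      by (cases e) (auto simp: domP in_set_conv_nth)
    then show "e \<in> set (vwalk_arcs ys) \<union> (set (vwalk_arcs ys))\<inverse>"
      using adj_ys by (auto simp: set_vwalk_arcs_conv_nth)
  next
    fix e assume "e \<in> set (vwalk_arcs ys) \<union> (set (vwalk_arcs ys))\<inverse>"
    then obtain i where "Suc i < length ys"
      "e = (ys ! i, ys ! Suc i) \<or> e = (ys ! Suc i, ys ! i)"
      by (auto simp: set_vwalk_arcs_conv_nth)
    then show "e \<in> arcs_ends P" by (auto simp: domP adj_ys)
  qed
  have pathP: "path_graph P"
    unfolding path_graph_def using simpleP ys_ne ys_dist vertsP arcsP by blast
  have cardP: "card (verts P) = d - 3" using vertsP distinct_card[OF ys_dist] lys by simp
  \<comment> \<open>The middle indices of a path with \<open>d - 3\<close> vertices, whence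
    \<open>d - 4\<close> in the first.\<close>
  have central: "central_vertex P c \<longleftrightarrow> c = ys ! ((d - 4) div 2) \<or> c = ys ! ((d - 3) div 2)" for c
    using path_graph_central_vertex_iff[OF simpleP ys_dist ys_ne vertsP arcsP] lys by simp
  have even_case: "odd (card (verts P)) \<and> (\<exists>!c. central_vertex P c)" if "even d"
  proof -
    \<comment> \<open>For even \<open>d\<close> both descriptions name the same vertex, which gives
      uniqueness.\<close>
    have "(d - 4) div 2 = (d - 3) div 2" "odd (d - 3)" using that d by presburger+
    then show ?thesis using central cardP by simp
  qed
  have odd_case: "even (card (verts P)) \<and> (\<exists>a b. central_edge P a b)" if "odd d"
  proof -
    \<comment> \<open>For odd \<open>d\<close> the middle indices are consecutive, so the two
      central vertices are adjacent in \<open>P\<close>.\<close>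
    have mid: "(d - 3) div 2 = Suc ((d - 4) div 2)" "(d - 3) div 2 < d - 3" "even (d - 3)"
      using that d by presburger+
    then have "ys ! ((d - 4) div 2) \<rightarrow>\<^bsub>P\<^esub> ys ! ((d - 3) div 2)"
      using lys by (simp add: domP adj_ys)
    then show ?thesis using mid central cardP unfolding central_edge_def by metis
  qed
  show ?thesis using surv pathP cardP even_case odd_case by blast
qed

end
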